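(* Let $L_g$ be the relevant ground program for some ProbLog program $L$ with respect to query atoms $\mathbf{Q}$ and evidence $\mathbf{E}=\mathbf{e}$. Let $MOD_{\mathbf{E}=\mathbf{e}}(L_g)$ be the set of those models in $MOD(L_g)$ that are consistent with the evidence $\mathbf{E}=\mathbf{e}$. Let $\varphi=\varphi_r\wedge\varphi_e$ denote the CNF and $w(\cdot)$ the weight function of the weighted CNF derived from $L_g$. Then: (model equivalence) $SAT(\varphi)=MOD_{\mathbf{E}=\mathbf{e}}(L_g)$; (weight equivalence) for all $\omega\in SAT(\varphi)$: $w(\omega)=P_{L_g}(\omega)$, i.e. the weight of $\omega$ according to $w(\cdot)$ equals the probability of $\omega$ according to $L_g$.
   Context: **Logic programs.** A (normal) logic program is a set of rules $h \leftarrow b_1,\dots,b_n$, where the head $h$ is an atom and the body literals $b_i$ are atoms or negated atoms. A fact is a rule with empty (true) body. Rules are universally quantified and are identified with their groundings over the Herbrand universe. $WFM(P)$ denotes the (in general three-valued) well-founded model of a logic program $P$; for negation-free $P$ it is the least Herbrand model. A *world* is a (two-valued) assignment of truth values to all ground atoms under consideration. **ProbLog programs.** A ProbLog program $L$ consists of a set of probabilistic facts $p::f$ ($f$ an atom, $p\in[0,1]$) and a set $R$ of logic program rules. Ground instances of the facts $f$ are called ground probabilistic atoms; ground instances of rule heads are called derived atoms. These two sets must be disjoint. Each ground probabilistic atom $f$ has one associated probability $p_f$, and there are finitely many ground probabilistic atoms. The query set $\mathbf{Q}$ and evidence set $\mathbf{E}$ are sets of ground probabilistic or derived atoms, and $\mathbf{e}$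 is a vector of truth values for $\mathbf{E}$. **Semantics.** A *total choice* $C$ is a subset of the set $F$ of ground probabilistic atoms; its probability is $\prod_{f\in C}p_f\prod_{f\in F\setminus C}(1-p_f)$. A world $\omega$ is a *model* of $L$ if $WFM(C\cup R)=\omega$ for some total choice $C$ (then $C$ is the set of probabilistic atoms true in $\omega$). $MOD(L)$ is the set of models of $L$. $P_L(\omega)$ is the probability of this $C$ if $\omega\in MOD(L)$, and $0$ otherwise. Standing assumption: for the given program $L$, $WFM(C\cup R)$ is two-valued for every total choice $C$. The same definitions of $MOD$ and $P$ are applied to $L_g$. **Relevant ground program.** A ground rule is *inactive* if its body contains a literal that is false in the evidence $\mathbf{E}=\mathbf{e}$ (an atom of $\mathbf{E}$ false in $\mathbf{e}$, or the negation of an atom of $\mathbf{E}$ true in $\mathbf{e}$). The *relevant atoms* form the smallest set of ground atoms that contains $\mathbf{Q}\cup\mathbf{E}$ and contains every atom occurring (positively or negatively) in the body of any ground rule of $L$ that is not inactive and whose head is in the set. $L_g$ is the ground ProbLog program whose rules are the ground rules of $L$ that are not inactive and have a relevant head, and whose probabilistic facts are the ground probabilistic facts $p_f::f$ of $L$ with $f$ relevant. Worlds of $L_g$ are truth assignments to the relevant atoms. $L_g$ is assumed finite (finitely many relevant atoms and rules). **Weighted CNF derived from $L_g$.** $\varphi_r$ is a propositional CNF obtained from the rules of $L_g$ by an equivalence-preserving conversion from logic programming semantics to classical semantics. $\varphi_r$ is over the atoms of $L_g$ and possibly additional auxiliary atoms. The defining property of the conversion is that $SAT(\varphi_r)=MOD(L_g)$,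 where the auxiliary atoms are omitted from the models in $SAT(\varphi_r)$; in every model of $\varphi_r$ the truth values of the auxiliary atoms are uniquely determined by those of the original atoms. $\varphi_e$ is the conjunction of the unit clauses $a$ for each $a\in\mathbf{E}$ that is true in $\mathbf{e}$ and $\neg a$ for each $a\in\mathbf{E}$ that is false in $\mathbf{e}$. $SAT(\varphi)$ is the set of classical models of $\varphi$, viewed as truth assignments to all atoms of $L_g$ (auxiliary atoms omitted). The weight function assigns to literals: $w(f)=p_f$ and $w(\neg f)=1-p_f$ for each probabilistic fact $p_f::f$ of $L_g$, and weight $1$ to every literal whose atom does not occur in a probabilistic fact. The weight of a world is $w(\omega)=\prod_{l} w(l)$, the product over all literals $l$ true in $\omega$. *)

theory Defs
  imports Complex_Main
begin

section \<open>Normal logic programs and the well-founded model\<close>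

datatype 'a lit = Pos 'a | Neg 'a

fun atom_of :: "'a lit \<Rightarrow> 'a" where
  "atom_of (Pos a) = a"
| "atom_of (Neg a) = a"

fun compl :: "'a lit \<Rightarrow> 'a lit" where
  "compl (Pos a) = Neg a"
| "compl (Neg a) = Pos a"

datatype (rule_atoms: 'a) rule = Rule (head: 'a) (body: "'a lit list")

abbreviation fact :: "'a \<Rightarrow> 'a rule" where
  "fact a \<equiv> Rule a []"

text \<open>
  A three-valued interpretation over a set \<open>B\<close> of ground atoms is the set of literals over \<open>B\<close>
  that are true in it. A (two-valued) world over \<open>B\<close> is given by the set \<open>\<omega> \<subseteq> B\<close> of its true
  atoms; \<open>world_lits B \<omega>\<close> is the set of literals true in that world.
\<close>

definition world_lits :: "'a set \<Rightarrow> 'a set \<Rightarrow> 'a lit set" where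
  "world_lits B \<omega> = Pos ` \<omega> \<union> Neg ` (B - \<omega>)"

definition two_valued :: "'a set \<Rightarrow> 'a lit set \<Rightarrow> bool" where
  "two_valued B I \<longleftrightarrow> (\<exists>\<omega>\<subseteq>B. I = world_lits B \<omega>)"

text \<open>
  The well-founded model of Van Gelder, Ross and Schlipf: the least fixpoint of the operator that
  adds the immediate consequences of an interpretation and the negations of the atoms in its
  greatest unfounded set.
\<close>

definition immediate_consequences :: "'a rule set \<Rightarrow> 'a lit set \<Rightarrow> 'a set" where
  "immediate_consequences P I = {head r |r. r \<in> P \<and> set (body r) \<subseteq> I}"

definition unfounded :: "'a rule set \<Rightarrow> 'a lit set \<Rightarrow> 'a set \<Rightarrow> bool" where
  "unfounded P I U \<longleftrightarrow>
     (\<forall>r\<in>P. head r \<in> U \<longrightarrow>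
        (\<exists>l\<in>set (body r). compl l \<in> I) \<or> (\<exists>a\<in>U. Pos a \<in> set (body r)))"

definition greatest_unfounded :: "'a set \<Rightarrow> 'a rule set \<Rightarrow> 'a lit set \<Rightarrow> 'a set" where
  "greatest_unfounded B P I = \<Union>{U. U \<subseteq> B \<and> unfounded P I U}"

definition wf_operator :: "'a set \<Rightarrow> 'a rule set \<Rightarrow> 'a lit set \<Rightarrow> 'a lit set" where
  "wf_operator B P I = Pos ` immediate_consequences P I \<union> Neg ` greatest_unfounded B P I"

definition WFM :: "'a set \<Rightarrow> 'a rule set \<Rightarrow> 'a lit set" where
  "WFM B P = lfp (wf_operator B P)"

lemma mono_wf_operator: "mono (wf_operator B P)"
proof (rule monoI)
  fix I J :: "'a lit set"
  assume IJ: "I \<subseteq> J"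
  have "unfounded P J U" if "unfounded P I U" for U
    using that IJ unfolding unfounded_def by blast
  moreover have "immediate_consequences P I \<subseteq> immediate_consequences P J"
    using IJ unfolding immediate_consequences_def by blast
  ultimately show "wf_operator B P I \<subseteq> wf_operator B P J"
    unfolding wf_operator_def greatest_unfounded_def by blast
qed


section \<open>First-order syntax and grounding\<close>

datatype ('f, vars_trm: 'v) trm = Var 'v | Fun 'f "('f, 'v) trm list"

datatype ('p, 'f, vars_atom: 'v) atom = Atom 'p "('f, 'v) trm list"

text \<open>Function and predicate symbols together with their arities; constants have arity 0.\<close>

record ('p, 'f) lang =
  funs :: "('f \<times> nat) set"
  preds :: "('p \<times> nat) set"

fun trm_over :: "('p, 'f) lang \<Rightarrow> ('f, 'v) trm \<Rightarrow> bool" where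
  "trm_over \<Sigma> (Var x) \<longleftrightarrow> True"
| "trm_over \<Sigma> (Fun f ts) \<longleftrightarrow> (f, length ts) \<in> funs \<Sigma> \<and> (\<forall>t\<in>set ts. trm_over \<Sigma> t)"

fun atom_over :: "('p, 'f) lang \<Rightarrow> ('p, 'f, 'v) atom \<Rightarrow> bool" where
  "atom_over \<Sigma> (Atom p ts) \<longleftrightarrow> (p, length ts) \<in> preds \<Sigma> \<and> (\<forall>t\<in>set ts. trm_over \<Sigma> t)"

definition herbrand_universe :: "('p, 'f) lang \<Rightarrow> ('f, 'v) trm set" where
  "herbrand_universe \<Sigma> = {t. trm_over \<Sigma> t \<and> vars_trm t = {}}"

definition herbrand_base :: "('p, 'f) lang \<Rightarrow> ('p, 'f, 'v) atom set" where
  "herbrand_base \<Sigma> = {a. atom_over \<Sigma> a \<and> vars_atom a = {}}"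

fun subst_trm :: "('v \<Rightarrow> ('f, 'v) trm) \<Rightarrow> ('f, 'v) trm \<Rightarrow> ('f, 'v) trm" where
  "subst_trm \<sigma> (Var x) = \<sigma> x"
| "subst_trm \<sigma> (Fun f ts) = Fun f (map (subst_trm \<sigma>) ts)"

fun subst_atom :: "('v \<Rightarrow> ('f, 'v) trm) \<Rightarrow> ('p, 'f, 'v) atom \<Rightarrow> ('p, 'f, 'v) atom" where
  "subst_atom \<sigma> (Atom p ts) = Atom p (map (subst_trm \<sigma>) ts)"


section \<open>ProbLog programs\<close>

text \<open>
  The type \<open>'a\<close> is the type of atoms. Programs with variables are programs over
  \<open>('p, 'f, 'v) atom\<close>; the semantic notions below are applied to ground programs, over a set
  \<open>B\<close> of ground atoms under consideration.
\<close>

record 'a problog =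
  pfacts :: "(real \<times> 'a) set"
  rules :: "'a rule set"

definition ground ::
    "('p, 'f) lang \<Rightarrow> ('p, 'f, 'v) atom problog \<Rightarrow> ('p, 'f, 'v) atom problog" where
  "ground \<Sigma> L = \<lparr>
     pfacts = {(p, subst_atom \<sigma> f) |p f \<sigma>.
       (p, f) \<in> pfacts L \<and> \<sigma> ` vars_atom f \<subseteq> herbrand_universe \<Sigma>},
     rules = {map_rule (subst_atom \<sigma>) r |r \<sigma>.
       r \<in> rules L \<and> \<sigma> ` (\<Union>a\<in>rule_atoms r. vars_atom a) \<subseteq> herbrand_universe \<Sigma>}\<rparr>"

definition prob_atoms :: "'a problog \<Rightarrow> 'a set" where
  "prob_atoms G = snd ` pfacts G"

definition derived_atoms :: "'a problog \<Rightarrow> 'a set" where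
  "derived_atoms G = head ` rules G"

definition prob_of :: "'a problog \<Rightarrow> 'a \<Rightarrow> real" where
  "prob_of G f = (THE p. (p, f) \<in> pfacts G)"

definition problog_program :: "('p, 'f) lang \<Rightarrow> ('p, 'f, 'v) atom problog \<Rightarrow> bool" where
  "problog_program \<Sigma> L \<longleftrightarrow>
     (\<forall>(p, f)\<in>pfacts L. 0 \<le> p \<and> p \<le> 1 \<and> atom_over \<Sigma> f) \<and>
     (\<forall>r\<in>rules L. \<forall>a\<in>rule_atoms r. atom_over \<Sigma> a) \<and>
     prob_atoms (ground \<Sigma> L) \<inter> derived_atoms (ground \<Sigma> L) = {} \<and>
     (\<forall>f\<in>prob_atoms (ground \<Sigma> L). \<exists>!p. (p, f) \<in> pfacts (ground \<Sigma> L)) \<and>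
     finite (prob_atoms (ground \<Sigma> L))"

definition total_choices :: "'a problog \<Rightarrow> 'a set set" where
  "total_choices G = Pow (prob_atoms G)"

definition choice_prob :: "'a problog \<Rightarrow> 'a set \<Rightarrow> real" where
  "choice_prob G C = (\<Prod>f\<in>C. prob_of G f) * (\<Prod>f\<in>prob_atoms G - C. 1 - prob_of G f)"

definition choice_WFM :: "'a set \<Rightarrow> 'a problog \<Rightarrow> 'a set \<Rightarrow> 'a lit set" where
  "choice_WFM B G C = WFM B (fact ` C \<union> rules G)"

definition MODELS :: "'a set \<Rightarrow> 'a problog \<Rightarrow> 'a set set" where
  "MODELS B G = {\<omega>. \<omega> \<subseteq> B \<and> (\<exists>C\<in>total_choices G. choice_WFM B G C = world_lits B \<omega>)}"

definition world_prob :: "'a set \<Rightarrow> 'a problog \<Rightarrow> 'a set \<Rightarrow> real" where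
  "world_prob B G \<omega> =
     (if \<omega> \<in> MODELS B G
      then choice_prob G (THE C. C \<in> total_choices G \<and> choice_WFM B G C = world_lits B \<omega>)
      else 0)"


section \<open>Evidence and the relevant ground program\<close>

text \<open>
  Evidence is given by a set \<open>E\<close> of ground atoms and their truth values \<open>e\<close>; the values of \<open>e\<close>
  outside \<open>E\<close> are never used.
\<close>

definition consistent_with :: "'a set \<Rightarrow> ('a \<Rightarrow> bool) \<Rightarrow> 'a set \<Rightarrow> bool" where
  "consistent_with E e \<omega> \<longleftrightarrow> (\<forall>a\<in>E. a \<in> \<omega> \<longleftrightarrow> e a)"

fun false_in_evidence :: "'a set \<Rightarrow> ('a \<Rightarrow> bool) \<Rightarrow> 'a lit \<Rightarrow> bool" where
  "false_in_evidence E e (Pos a) \<longleftrightarrow> a \<in> E \<and> \<not> e a"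
| "false_in_evidence E e (Neg a) \<longleftrightarrow> a \<in> E \<and> e a"

definition inactive :: "'a set \<Rightarrow> ('a \<Rightarrow> bool) \<Rightarrow> 'a rule \<Rightarrow> bool" where
  "inactive E e r \<longleftrightarrow> (\<exists>l\<in>set (body r). false_in_evidence E e l)"

inductive_set relevant_atoms ::
    "'a problog \<Rightarrow> 'a set \<Rightarrow> 'a set \<Rightarrow> ('a \<Rightarrow> bool) \<Rightarrow> 'a set"
  for G :: "'a problog" and Q E :: "'a set" and e :: "'a \<Rightarrow> bool" where
  query: "a \<in> Q \<Longrightarrow> a \<in> relevant_atoms G Q E e"
| evidence: "a \<in> E \<Longrightarrow> a \<in> relevant_atoms G Q E e"
| body: "r \<in> rules G \<Longrightarrow> \<not> inactive E e r \<Longrightarrow> head r \<in> relevant_atoms G Q E e \<Longrightarrow>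
    l \<in> set (body r) \<Longrightarrow> atom_of l \<in> relevant_atoms G Q E e"

definition relevant_program ::
    "'a problog \<Rightarrow> 'a set \<Rightarrow> 'a set \<Rightarrow> ('a \<Rightarrow> bool) \<Rightarrow> 'a problog" where
  "relevant_program G Q E e = \<lparr>
     pfacts = {(p, f). (p, f) \<in> pfacts G \<and> f \<in> relevant_atoms G Q E e},
     rules = {r \<in> rules G. \<not> inactive E e r \<and> head r \<in> relevant_atoms G Q E e}\<rparr>"


section \<open>Weighted CNFs\<close>

text \<open>
  Clauses and CNFs are finite sets of literals and of clauses. The propositional atoms are the
  original atoms (\<open>Inl\<close>) and the auxiliary atoms introduced by the conversion (\<open>Inr\<close>).
\<close>

type_synonym 'b cnf = "'b lit set set"

definition cnf_over :: "'b set \<Rightarrow> 'b cnf \<Rightarrow> bool" where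
  "cnf_over V \<phi> \<longleftrightarrow> finite \<phi> \<and> (\<forall>c\<in>\<phi>. finite c \<and> atom_of ` c \<subseteq> V)"

definition classical_models :: "'b set \<Rightarrow> 'b cnf \<Rightarrow> 'b set set" where
  "classical_models V \<phi> = {\<nu>. \<nu> \<subseteq> V \<and> (\<forall>c\<in>\<phi>. c \<inter> world_lits V \<nu> \<noteq> {})}"

definition omit_aux :: "('a + 'x) set \<Rightarrow> 'a set" where
  "omit_aux \<nu> = Inl -` \<nu>"

definition SAT :: "'a set \<Rightarrow> 'x set \<Rightarrow> ('a + 'x) cnf \<Rightarrow> 'a set set" where
  "SAT A X \<phi> = omit_aux ` classical_models (A <+> X) \<phi>"

text \<open>
  \<open>\<phi>\<close> is the result of an equivalence-preserving conversion of the ground program \<open>G\<close> with atoms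
  \<open>A\<close>, using the auxiliary atoms \<open>X\<close>. Injectivity says that in each model of \<open>\<phi>\<close> the auxiliary
  atoms are determined by the original ones.
\<close>

definition equivalent_cnf :: "'a set \<Rightarrow> 'x set \<Rightarrow> 'a problog \<Rightarrow> ('a + 'x) cnf \<Rightarrow> bool" where
  "equivalent_cnf A X G \<phi> \<longleftrightarrow>
     cnf_over (A <+> X) \<phi> \<and>
     SAT A X \<phi> = MODELS A G \<and>
     inj_on omit_aux (classical_models (A <+> X) \<phi>)"

definition evidence_cnf :: "'a set \<Rightarrow> ('a \<Rightarrow> bool) \<Rightarrow> ('a + 'x) cnf" where
  "evidence_cnf E e = {{Pos (Inl a)} |a. a \<in> E \<and> e a} \<union> {{Neg (Inl a)} |a. a \<in> E \<and> \<not> e a}"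

fun lit_weight :: "'a problog \<Rightarrow> ('a + 'x) lit \<Rightarrow> real" where
  "lit_weight G (Pos (Inl a)) = (if a \<in> prob_atoms G then prob_of G a else 1)"
| "lit_weight G (Neg (Inl a)) = (if a \<in> prob_atoms G then 1 - prob_of G a else 1)"
| "lit_weight G (Pos (Inr x)) = 1"
| "lit_weight G (Neg (Inr x)) = 1"

text \<open>The weight of a world over the original atoms \<open>A\<close>, for a weight function on literals.\<close>

definition world_weight :: "(('a + 'x) lit \<Rightarrow> real) \<Rightarrow> 'a set \<Rightarrow> 'a set \<Rightarrow> real" where
  "world_weight w A \<omega> = (\<Prod>l\<in>world_lits A \<omega>. w (map_lit Inl l))"

end

theory Submission
  imports Defs
begin

text \<open>
  Evidence constrains only original atoms, so conjoining the evidence clauses commutes with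
  omitting auxiliary atoms. A probabilistic atom heads no rule, so it is true in the well-founded
  model of a total choice iff it was chosen; hence a model determines its choice as
  \<open>\<omega> \<inter> prob_atoms G\<close>, and the weight of the model factors as the probability of this choice.
\<close>

lemma Pos_in_world_lits [simp]: "Pos a \<in> world_lits B \<omega> \<longleftrightarrow> a \<in> \<omega>"
  by (auto simp: world_lits_def)

lemma Neg_in_world_lits [simp]: "Neg a \<in> world_lits B \<omega> \<longleftrightarrow> a \<in> B \<and> a \<notin> \<omega>"
  by (auto simp: world_lits_def)

text \<open>\<open>WFM B P\<close> is a fixpoint of \<open>wf_operator\<close>, and that operator
  produces positive literals only as immediate consequences; unfounded sets contribute negative
  ones.\<close>

lemma Pos_in_WFM_iff: "Pos a \<in> WFM B P \<longleftrightarrow> (\<exists>r\<in>P. head r = a \<and> set (body r) \<subseteq> WFM B P)"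
proof -
  have "WFM B P = wf_operator B P (WFM B P)"
    unfolding WFM_def by (rule lfp_unfold[OF mono_wf_operator])
  then have "Pos a \<in> WFM B P \<longleftrightarrow> Pos a \<in> wf_operator B P (WFM B P)"
    by simp
  also have "\<dots> \<longleftrightarrow> (\<exists>r\<in>P. head r = a \<and> set (body r) \<subseteq> WFM B P)"
    by (auto simp: wf_operator_def immediate_consequences_def)
  finally show ?thesis .
qed

lemma choice_eq_true_prob_atoms:
  assumes "prob_atoms G \<inter> derived_atoms G = {}"
    and "C \<in> total_choices G"
    and "choice_WFM B G C = world_lits B \<omega>"
  shows "C = \<omega> \<inter> prob_atoms G"
proof -
  have C: "C \<subseteq> prob_atoms G"
    using assms(2) by (simp add: total_choices_def)
  have "f \<in> \<omega> \<longleftrightarrow> f \<in> C" if "f \<in> prob_atoms G" for f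
  proof -
    have "f \<in> \<omega> \<longleftrightarrow> Pos f \<in> choice_WFM B G C"
      by (simp add: assms(3))
    moreover have "head r \<noteq> f" if "r \<in> rules G" for r
      using assms(1) \<open>f \<in> prob_atoms G\<close> that by (auto simp: derived_atoms_def)
    ultimately show ?thesis
      unfolding choice_WFM_def Pos_in_WFM_iff[of f] by (auto simp: bex_Un)
  qed
  with C show ?thesis by auto
qed

lemma world_prob_eq_choice_prob:
  assumes "prob_atoms G \<inter> derived_atoms G = {}" and "\<omega> \<in> MODELS B G"
  shows "world_prob B G \<omega> = choice_prob G (\<omega> \<inter> prob_atoms G)"
proof -
  obtain C where C: "C \<in> total_choices G" "choice_WFM B G C = world_lits B \<omega>"
    using assms(2) by (auto simp: MODELS_def)
  \<comment> \<open>Uniqueness: every choice yielding \<open>\<omega>\<close> equals the same set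
    \<open>\<omega> \<inter> prob_atoms G\<close>.\<close>
  then have "(THE C. C \<in> total_choices G \<and> choice_WFM B G C = world_lits B \<omega>) = C"
    using choice_eq_true_prob_atoms[OF assms(1)] by (intro the_equality) blast+
  with C choice_eq_true_prob_atoms[OF assms(1) C] assms(2) show ?thesis
    by (simp add: world_prob_def)
qed

text \<open>The product splits into true and false atoms. Atoms outside \<open>prob_atoms G\<close>
  contribute the factor 1, so each part shrinks to the probabilistic atoms.\<close>

lemma world_weight_eq_choice_prob:
  fixes G :: "'a problog"
  assumes "finite A" and "\<omega> \<subseteq> A" and "prob_atoms G \<subseteq> A"
  shows "world_weight (lit_weight G :: ('a + 'x) lit \<Rightarrow> real) A \<omega> = choice_prob G (\<omega> \<inter> prob_atoms G)"
proof -
  let ?w = "\<lambda>l. lit_weight G (map_lit Inl l :: ('a + 'x) lit)"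
  have fin: "finite \<omega>" "finite (A - \<omega>)"
    using assms by (auto intro: finite_subset)
  have "world_weight (lit_weight G :: ('a + 'x) lit \<Rightarrow> real) A \<omega> = prod ?w (Pos ` \<omega>) * prod ?w (Neg ` (A - \<omega>))"
    unfolding world_weight_def world_lits_def using fin by (intro prod.union_disjoint) auto
  also have "prod ?w (Pos ` \<omega>) = (\<Prod>a\<in>\<omega>. if a \<in> prob_atoms G then prob_of G a else 1)"
    by (subst prod.reindex) (auto simp: inj_on_def)
  also have "\<dots> = (\<Prod>f\<in>\<omega> \<inter> prob_atoms G. prob_of G f)"
    using fin by (simp add: prod.inter_restrict)
  also have "prod ?w (Neg ` (A - \<omega>)) =
      (\<Prod>a\<in>A - \<omega>. if a \<in> prob_atoms G then 1 - prob_of G a else 1)"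
    by (subst prod.reindex) (auto simp: inj_on_def)
  also have "\<dots> = (\<Prod>f\<in>(A - \<omega>) \<inter> prob_atoms G. 1 - prob_of G f)"
    using fin by (simp add: prod.inter_restrict)
  \<comment> \<open>Since \<open>prob_atoms G \<subseteq> A\<close>, the false probabilistic atoms
    in \<open>A\<close> are exactly the unchosen ones.\<close>
  also have "(A - \<omega>) \<inter> prob_atoms G = prob_atoms G - \<omega> \<inter> prob_atoms G"
    using assms(3) by auto
  finally show ?thesis by (simp add: choice_prob_def)
qed

text \<open>A unit clause is satisfied iff its literal is true. The assumption
  \<open>E \<subseteq> A\<close> matters for negative evidence: \<open>Neg (Inl a)\<close> counts as
  true only for \<open>Inl a\<close> in \<open>A <+> X\<close>.\<close>

lemma satisfies_evidence_cnf_iff: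
  assumes "E \<subseteq> A"
  shows "(\<forall>c\<in>evidence_cnf E e. c \<inter> world_lits (A <+> X) \<nu> \<noteq> {}) \<longleftrightarrow>
    consistent_with E e (omit_aux \<nu>)"
proof -
  \<comment> \<open>Each evidence atom has exactly one unit clause, so quantifying over clauses
    becomes quantifying over \<open>E\<close>.\<close>
  have "(\<forall>c\<in>evidence_cnf E e. c \<inter> world_lits (A <+> X) \<nu> \<noteq> {}) \<longleftrightarrow>
      (\<forall>a\<in>E. (if e a then Pos (Inl a) else Neg (Inl a)) \<in> world_lits (A <+> X) \<nu>)"
    (is "?L \<longleftrightarrow> ?R")
  proof
    assume L: ?L
    show ?R
    proof
      fix a
      assume "a \<in> E"
      then have "{if e a then Pos (Inl a) else Neg (Inl a)} \<in> evidence_cnf E e"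
        by (simp add: evidence_cnf_def)
      with L show "(if e a then Pos (Inl a) else Neg (Inl a)) \<in> world_lits (A <+> X) \<nu>"
        by blast
    qed
  next
    assume ?R
    then show ?L
      by (auto simp: evidence_cnf_def)
  qed
  also have "\<dots> \<longleftrightarrow> (\<forall>a\<in>E. Inl a \<in> \<nu> \<longleftrightarrow> e a)"
    using assms by (intro ball_cong) auto
  finally show ?thesis
    by (simp add: consistent_with_def omit_aux_def)
qed

text \<open>The evidence condition depends on \<open>\<nu>\<close> only through
  \<open>omit_aux \<nu>\<close>, so filtering before or after taking the image under
  \<open>omit_aux\<close> is the same.\<close>

lemma SAT_evidence_cnf:
  assumes "E \<subseteq> A"
  shows "SAT A X (\<phi> \<union> evidence_cnf E e) = {\<omega> \<in> SAT A X \<phi>. consistent_with E e \<omega>}"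
  unfolding SAT_def classical_models_def ball_Un satisfies_evidence_cnf_iff[OF assms] by blast

lemma prob_atoms_relevant_program:
  "prob_atoms (relevant_program G Q E e) = prob_atoms G \<inter> relevant_atoms G Q E e"
  by (force simp: prob_atoms_def relevant_program_def)

lemma derived_atoms_relevant_program: "derived_atoms (relevant_program G Q E e) \<subseteq> derived_atoms G"
  by (auto simp: derived_atoms_def relevant_program_def)

theorem theorem2:
  fixes \<Sigma> :: "('p, 'f) lang"
    and L G Lg :: "('p, 'f, 'v) atom problog"
    and Q E A :: "('p, 'f, 'v) atom set"
    and e :: "('p, 'f, 'v) atom \<Rightarrow> bool"
    and X :: "'x set"
    and \<phi>\<^sub>r \<phi> :: "(('p, 'f, 'v) atom + 'x) cnf"
    and w :: "(('p, 'f, 'v) atom + 'x) lit \<Rightarrow> real"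
  assumes "problog_program \<Sigma> L"
    and "G = ground \<Sigma> L"
    and "\<forall>C\<in>total_choices G. two_valued (herbrand_base \<Sigma>) (choice_WFM (herbrand_base \<Sigma>) G C)"
    and "Q \<subseteq> prob_atoms G \<union> derived_atoms G"
    and "E \<subseteq> prob_atoms G \<union> derived_atoms G"
    and "A = relevant_atoms G Q E e"
    and "Lg = relevant_program G Q E e"
    and "finite A" and "finite (rules Lg)"
    and "finite X" and "equivalent_cnf A X Lg \<phi>\<^sub>r"
    and "\<phi> = \<phi>\<^sub>r \<union> evidence_cnf E e"
    and "w = lit_weight Lg"
  shows "SAT A X \<phi> = {\<omega> \<in> MODELS A Lg. consistent_with E e \<omega>}
    \<and> (\<forall>\<omega>\<in>SAT A X \<phi>. world_weight w A \<omega> = world_prob A Lg \<omega>)"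
proof -
  have "E \<subseteq> A"
    unfolding assms(6) by (auto intro: relevant_atoms.evidence)
  moreover have "SAT A X \<phi>\<^sub>r = MODELS A Lg"
    using assms(11) by (simp add: equivalent_cnf_def)
  ultimately have sat: "SAT A X \<phi> = {\<omega> \<in> MODELS A Lg. consistent_with E e \<omega>}"
    unfolding assms(12) by (simp add: SAT_evidence_cnf)
  have "prob_atoms G \<inter> derived_atoms G = {}"
    using assms(1,2) by (simp add: problog_program_def)
  \<comment> \<open>Disjointness is inherited because both sets can only shrink in passing from
    \<open>G\<close> to \<open>Lg\<close>.\<close>
  then have disj: "prob_atoms Lg \<inter> derived_atoms Lg = {}"
    unfolding assms(7) prob_atoms_relevant_program
    using derived_atoms_relevant_program[of G Q E e] by blast
  have "prob_atoms Lg \<subseteq> A"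
    unfolding assms(6,7) prob_atoms_relevant_program by simp
  \<comment> \<open>The equation is shown on all of \<open>MODELS A Lg\<close>; by
    \<open>sat\<close> this covers every world in \<open>SAT A X \<phi>\<close>.\<close>
  then have "world_weight w A \<omega> = world_prob A Lg \<omega>" if "\<omega> \<in> MODELS A Lg" for \<omega>
  proof -
    have "\<omega> \<subseteq> A"
      using that by (simp add: MODELS_def)
    with \<open>prob_atoms Lg \<subseteq> A\<close> show ?thesis
      unfolding assms(13) world_prob_eq_choice_prob[OF disj that]
      by (intro world_weight_eq_choice_prob assms(8))
  qed
  with sat show ?thesis by simp
qed

end
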